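(* Consider the problem $\max_{\mathbf{x}\in C}F(\mathbf{x})$ with $C\subseteq\mathbb{R}^n$ and $F:\mathbb{R}^n\to\mathbb{R}$ non-negative and differentiable, and let $\mathbf{x}^*\in\operatorname{argmax}_{\mathbf{x}\in C}F(\mathbf{x})$. Let $[0,T]\ni t\mapsto\mathbf{x}(t)\in\mathbb{R}^n$ be a differentiable continuous-time algorithm, starting from $\mathbf{x}(0)\in C$ and outputting $\mathbf{x}(T)\in C$. Let $(a,b)\in Q$, where $Q$ is the class of pairs of differentiable functions on $[0,T]$ with $a_0>0$, $\dot a_t\ge 0$, $b_0\ge 0$, $\dot b_t\ge 0$, and put $$E(\mathbf{x}(t))=a_tF(\mathbf{x}(t))-b_tF(\mathbf{x}^* ).$$ Suppose that an upper bound $U_t\ge F(\mathbf{x}^* )$, $t\in[0,T]$, not depending on $\mathbf{x}^*$, is available in the form $$U_t=c(\mathbf{x}(t))F(\mathbf{x}(t))+d(t)\langle\nabla F(\mathbf{x}(t)),\mathbf{u}(\mathbf{x}(t))\rangle,$$ where $c(\mathbf{x}(t))>0$ is a scalar function of $\mathbf{x}(t)$, $d(t)$ is a scalar function, and $\mathbf{u}(\mathbf{x}(t))\in\mathbb{R}^n$ is a vector-valued function of $\mathbf{x}(t)$ with $\|\mathbf{u}(\mathbf{x}(t))\|^2\le D=\max_{\mathbf{x},\mathbf{y}\in C}\|\mathbf{x}-\mathbf{y}\|^2$; any extra constraints on $c$ and $d$ related to the algorithm are collected in a set $O$. Then a sufficient condition for $\dot E(\mathbf{x}(t))\ge 0$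 is $$\dot a_t\ge\dot b_t\,c(\mathbf{x}(t)),\qquad \dot{\mathbf{x}}(t)=\frac{\dot b_t}{a_t}\,d(t)\,\mathbf{u}(\mathbf{x}(t)),\qquad c(\mathbf{x}(t))\in O.$$ Consequently, if this holds for all $t\in[0,T]$, then $E(\mathbf{x}(t))$ is non-decreasing on $[0,T]$ and $$F(\mathbf{x}(T))\ \ge\ \frac{b_T-b_0}{a_T}F(\mathbf{x}^* )+\frac{a_0}{a_T}F(\mathbf{x}(0))\ \ge\ \frac{b_T-b_0}{a_T}F(\mathbf{x}^* ).$$
   Context: A dot denotes the time derivative, $\langle\cdot,\cdot\rangle$ the Euclidean inner product and $\|\cdot\|$ the Euclidean norm. The bound $U_t$ may depend on $\mathbf{x}(s)$, $s\in[0,t]$. The set $O$ is problem-specific: it collects the additional constraints on the functions in $U_t$ that arise when the bound $U_t\ge F(\mathbf{x}^* )$ is derived for the problem at hand (for instance, in one application $c(\mathbf{x}(t))=1/(1-\theta(\mathbf{x}(t)))$ and $O$ requires $0<1/c\le 1-\|\mathbf{x}(t)\|_\infty$ for $t\in[0,T]$); it may impose no constraint. *)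

theory Defs
  imports "HOL-Analysis.Analysis"
begin

(* Derivatives along [0,T] are taken within the interval, hence one-sided at its endpoints. *)
definition time_deriv :: "real \<Rightarrow> (real \<Rightarrow> 'a::real_normed_vector) \<Rightarrow> real \<Rightarrow> 'a" where
  "time_deriv T f t = vector_derivative f (at t within {0..T})"

definition grad :: "('a::real_inner \<Rightarrow> real) \<Rightarrow> 'a \<Rightarrow> 'a" where
  "grad F y = (THE D. GDERIV F y :> D)"

(* Relational form of D = max {|y - z|^2 | y, z in C}: the maximum is attained. *)
definition is_sq_diameter :: "'a::real_normed_vector set \<Rightarrow> real \<Rightarrow> bool" where
  "is_sq_diameter C D \<longleftrightarrow>
     (\<exists>y\<in>C. \<exists>z\<in>C. D = (norm (y - z))\<^sup>2) \<and> (\<forall>y\<in>C. \<forall>z\<in>C. (norm (y - z))\<^sup>2 \<le> D)"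

definition Q_class :: "real \<Rightarrow> ((real \<Rightarrow> real) \<times> (real \<Rightarrow> real)) set" where
  "Q_class T = {(a, b).
     a differentiable_on {0..T} \<and> b differentiable_on {0..T} \<and>
     a 0 > 0 \<and> (\<forall>t\<in>{0..T}. time_deriv T a t \<ge> 0) \<and>
     b 0 \<ge> 0 \<and> (\<forall>t\<in>{0..T}. time_deriv T b t \<ge> 0)}"

definition energy ::
  "(real \<Rightarrow> real) \<Rightarrow> (real \<Rightarrow> real) \<Rightarrow> ('a \<Rightarrow> real) \<Rightarrow> 'a \<Rightarrow> (real \<Rightarrow> 'a) \<Rightarrow> real \<Rightarrow> real" where
  "energy a b F xs x t = a t * F (x t) - b t * F xs"

(* The trajectory x is fixed, so d may encode a dependence of the bound on x(s), s \<le> t. *)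
definition bound_form ::
  "('a::real_inner \<Rightarrow> real) \<Rightarrow> ('a \<Rightarrow> real) \<Rightarrow> (real \<Rightarrow> real) \<Rightarrow> ('a \<Rightarrow> 'a) \<Rightarrow> (real \<Rightarrow> 'a) \<Rightarrow> real \<Rightarrow> real" where
  "bound_form F c d u x t = c (x t) * F (x t) + d t * (grad F (x t) \<bullet> u (x t))"

(* The constraints in force at time t are a set Os t of admissible pairs of functions of time,
   the first one being s \<mapsto> c(x(s)).  A constraint on the whole trajectory is a constant Os,
   and no constraint is Os t = UNIV. *)
definition satisfies_constraints ::
  "(real \<Rightarrow> ((real \<Rightarrow> real) \<times> (real \<Rightarrow> real)) set) \<Rightarrow> ('a \<Rightarrow> real) \<Rightarrow> (real \<Rightarrow> real) \<Rightarrow> (real \<Rightarrow> 'a) \<Rightarrow> real \<Rightarrow> bool" where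
  "satisfies_constraints Os c d x t \<longleftrightarrow> (\<lambda>s. c (x s), d) \<in> Os t"

definition sufficient_condition ::
  "real \<Rightarrow> (real \<Rightarrow> real) \<Rightarrow> (real \<Rightarrow> real) \<Rightarrow> ('a::real_normed_vector \<Rightarrow> real) \<Rightarrow> (real \<Rightarrow> real) \<Rightarrow> ('a \<Rightarrow> 'a)
    \<Rightarrow> (real \<Rightarrow> ((real \<Rightarrow> real) \<times> (real \<Rightarrow> real)) set) \<Rightarrow> (real \<Rightarrow> 'a) \<Rightarrow> real \<Rightarrow> bool" where
  "sufficient_condition T a b c d u Os x t \<longleftrightarrow>
     time_deriv T a t \<ge> time_deriv T b t * c (x t) \<and>
     time_deriv T x t = (time_deriv T b t / a t * d t) *\<^sub>R u (x t) \<and>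
     satisfies_constraints Os c d x t"

end

(* The derivative of the energy is a' F(x) + a <grad F(x), x'> - b' F(xs).  The choice of x' makes
   the middle term b' d <grad F(x), u>, so with a' \<ge> b' c the derivative is at least
   b' (c F(x) + d <grad F(x), u> - F(xs)) \<ge> 0. *)
theory Submission
  imports Defs
begin

lemma has_vector_derivative_time_deriv:
  assumes "f differentiable_on {0..T}" "t \<in> {0..T}"
  shows "(f has_vector_derivative time_deriv T f t) (at t within {0..T})"
  using assms by (simp add: time_deriv_def differentiable_on_def vector_derivative_works)

text \<open>The condition \<open>0 < T\<close> makes the derivative within \<open>{0..T}\<close>
  unique, also at the endpoints, so any derivative found by the calculus rules is the one that
  \<open>time_deriv\<close> selects.\<close>

lemma time_deriv_eqI:
  assumes "0 < T" "t \<in> {0..T}" "(f has_vector_derivative f') (at t within {0..T})"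
  shows "time_deriv T f t = f'"
  unfolding time_deriv_def
  by (rule vector_derivative_within_cbox[of 0 T, unfolded box_real]) (use assms in auto)

text \<open>Mean value theorem on \<open>{r..s}\<close>: the increment is \<open>s - r\<close> times
  a derivative value, and both factors are nonnegative.\<close>

lemma mono_on_if_time_deriv_nonneg:
  fixes f :: "real \<Rightarrow> real"
  assumes diff: "f differentiable_on {0..T}"
    and nonneg: "\<And>t. t \<in> {0..T} \<Longrightarrow> 0 \<le> time_deriv T f t"
  shows "mono_on {0..T} f"
proof (rule mono_onI)
  fix r s assume rs: "r \<in> {0..T}" "s \<in> {0..T}" "r \<le> s"
  have "(f has_derivative (\<lambda>h. h *\<^sub>R time_deriv T f t)) (at t within {r..s})"
    if "r \<le> t" "t \<le> s" for t
    using has_vector_derivative_time_deriv[OF diff, of t] rs that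
    unfolding has_vector_derivative_def
    \<comment> \<open>A derivative within \<open>{0..T}\<close> restricts to the smaller interval
      \<open>{r..s}\<close>, so one-sided derivatives at 0 and \<open>T\<close> suffice.\<close>
    by (intro has_derivative_subset[where s = "{0..T}" and t = "{r..s}"]) auto
  from mvt_very_simple[OF \<open>r \<le> s\<close> this]
  obtain t where t: "t \<in> {r..s}" "f s - f r = (s - r) *\<^sub>R time_deriv T f t"
    by blast
  moreover have "0 \<le> time_deriv T f t"
    using nonneg rs t by auto
  ultimately show "f r \<le> f s"
    using rs by (metis diff_ge_0_iff_ge mult_nonneg_nonneg real_scaleR_def)
qed

lemma GDERIV_unique:
  assumes "GDERIV F y :> D" "GDERIV F y :> D'"
  shows "D = D'"
proof -
  have "(\<lambda>h. h \<bullet> D) = (\<lambda>h. h \<bullet> D')"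
    using assms has_derivative_unique unfolding gderiv_def by blast
  \<comment> \<open>Evaluating both functionals at \<open>h = D - D'\<close> gives that
    \<open>D - D'\<close> has inner product 0 with itself.\<close>
  then have "D \<bullet> (D - D') = D' \<bullet> (D - D')"
    by (metis inner_commute)
  then show ?thesis
    by (metis inner_diff_left inner_eq_zero_iff right_minus_eq)
qed

text \<open>Riesz representation in finite dimension: the derivative \<open>F'\<close> is the inner
  product with \<open>adjoint F' 1\<close>. Uniqueness then makes the definite description in
  \<open>grad\<close> well defined.\<close>

lemma GDERIV_grad:
  fixes F :: "'a::euclidean_space \<Rightarrow> real"
  assumes "F differentiable (at y)"
  shows "GDERIV F y :> grad F y"
proof -
  obtain F' where F': "(F has_derivative F') (at y)"
    using assms by (auto simp: differentiable_def)
  have "F' = (\<lambda>h. h \<bullet> adjoint F' 1)"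
    using adjoint_works[OF has_derivative_linear[OF F'], of _ 1] by simp
  then have "GDERIV F y :> adjoint F' 1"
    using F' unfolding gderiv_def by simp
  then show ?thesis
    unfolding grad_def by (metis theI GDERIV_unique)
qed

lemma energy_has_vector_derivative:
  fixes x :: "real \<Rightarrow> 'a::euclidean_space"
  assumes "F differentiable (at (x t))"
    and "a differentiable_on {0..T}" "b differentiable_on {0..T}" "x differentiable_on {0..T}"
    and "t \<in> {0..T}"
  shows "(energy a b F xs x has_vector_derivative
      time_deriv T a t * F (x t) + a t * (grad F (x t) \<bullet> time_deriv T x t) - time_deriv T b t * F xs)
      (at t within {0..T})"
proof -
  \<comment> \<open>The chain rule for within-derivatives asks for the outer derivative only within
    the image of the path.\<close>
  have "(F has_derivative (\<lambda>h. h \<bullet> grad F (x t))) (at (x t) within x ` {0..T})"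
    using GDERIV_grad[OF assms(1)] by (auto simp: gderiv_def intro: has_derivative_at_withinI)
  from vector_derivative_diff_chain_within[OF has_vector_derivative_time_deriv[OF assms(4,5)] this]
  have Fx: "((\<lambda>s. F (x s)) has_real_derivative grad F (x t) \<bullet> time_deriv T x t) (at t within {0..T})"
    by (simp add: o_def inner_commute has_real_derivative_iff_has_vector_derivative)
  note ab = assms(2,3)[THEN has_vector_derivative_time_deriv, OF assms(5),
      folded has_real_derivative_iff_has_vector_derivative]
  show ?thesis
    unfolding energy_def[abs_def] has_real_derivative_iff_has_vector_derivative[symmetric]
    by (rule derivative_eq_intros ab Fx refl)+ (simp add: algebra_simps)
qed

lemma time_deriv_energy_nonneg:
  fixes x :: "real \<Rightarrow> 'a::euclidean_space"
  assumes T: "0 < T" "t \<in> {0..T}"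
    and F: "F differentiable (at (x t))" "0 \<le> F (x t)"
    and diff: "a differentiable_on {0..T}" "b differentiable_on {0..T}" "x differentiable_on {0..T}"
    and "a t \<noteq> 0" "0 \<le> time_deriv T b t"
    and cond: "sufficient_condition T a b c d u Os x t"
    and bound: "F xs \<le> bound_form F c d u x t"
  shows "0 \<le> time_deriv T (energy a b F xs x) t"
proof -
  let ?a' = "time_deriv T a t" and ?b' = "time_deriv T b t"
  have a': "?b' * c (x t) \<le> ?a'"
    and x': "time_deriv T x t = (?b' / a t * d t) *\<^sub>R u (x t)"
    using cond by (auto simp: sufficient_condition_def)
  \<comment> \<open>The chain starts from the slack of the upper bound, weighted by
    \<open>?b'\<close>, and works up to the derivative of the energy.\<close>
  have "0 \<le> ?b' * (bound_form F c d u x t - F xs)"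
    using assms by simp
  also have "\<dots> = ?b' * c (x t) * F (x t) + ?b' * d t * (grad F (x t) \<bullet> u (x t)) - ?b' * F xs"
    by (simp add: bound_form_def algebra_simps)
  also have "\<dots> \<le> ?a' * F (x t) + ?b' * d t * (grad F (x t) \<bullet> u (x t)) - ?b' * F xs"
    using mult_right_mono[OF a' F(2)] by simp
  \<comment> \<open>Substituting the dynamics for \<open>time_deriv T x t\<close>, the factor
    \<open>a t\<close> cancels the denominator of the step size.\<close>
  also have "\<dots> = ?a' * F (x t) + a t * (grad F (x t) \<bullet> time_deriv T x t) - ?b' * F xs"
    using \<open>a t \<noteq> 0\<close> by (simp add: x')
  also have "\<dots> = time_deriv T (energy a b F xs x) t"
    using time_deriv_eqI[OF T energy_has_vector_derivative[OF F(1) diff T(2)]] by simp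
  finally show ?thesis .
qed

theorem mainTheorem1:
  fixes C :: "(real ^ 'n) set"
    and F :: "real ^ 'n \<Rightarrow> real"
    and xs :: "real ^ 'n"
    and T D :: real
    and x :: "real \<Rightarrow> real ^ 'n"
    and a b d :: "real \<Rightarrow> real"
    and c :: "real ^ 'n \<Rightarrow> real"
    and u :: "real ^ 'n \<Rightarrow> real ^ 'n"
    and Os :: "real \<Rightarrow> ((real \<Rightarrow> real) \<times> (real \<Rightarrow> real)) set"
  assumes T_pos: "0 < T"
    and F_nonneg: "\<And>y. 0 \<le> F y"
    and F_diff: "\<And>y. F differentiable (at y)"
    and xs_argmax: "is_arg_max F (\<lambda>y. y \<in> C) xs"
    and x_diff: "x differentiable_on {0..T}"
    and x_start: "x 0 \<in> C"
    and x_end: "x T \<in> C"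
    and ab_Q: "(a, b) \<in> Q_class T"
    and D_max: "is_sq_diameter C D"
    and c_pos: "\<And>t. t \<in> {0..T} \<Longrightarrow> 0 < c (x t)"
    and u_bound: "\<And>t. t \<in> {0..T} \<Longrightarrow> (norm (u (x t)))\<^sup>2 \<le> D"
    and U_bound: "\<And>t. t \<in> {0..T} \<Longrightarrow> satisfies_constraints Os c d x t
                    \<Longrightarrow> F xs \<le> bound_form F c d u x t"
  shows "energy a b F xs x differentiable_on {0..T} \<and>
    (\<forall>t\<in>{0..T}. sufficient_condition T a b c d u Os x t
        \<longrightarrow> 0 \<le> time_deriv T (energy a b F xs x) t) \<and>
    ((\<forall>t\<in>{0..T}. sufficient_condition T a b c d u Os x t) \<longrightarrow>
        mono_on {0..T} (energy a b F xs x) \<and>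
        F (x T) \<ge> (b T - b 0) / a T * F xs + a 0 / a T * F (x 0) \<and>
        (b T - b 0) / a T * F xs + a 0 / a T * F (x 0) \<ge> (b T - b 0) / a T * F xs)"
proof (intro conjI ballI impI)
  have diff: "a differentiable_on {0..T}" "b differentiable_on {0..T}"
    and a0: "0 < a 0"
    and a': "\<And>t. t \<in> {0..T} \<Longrightarrow> 0 \<le> time_deriv T a t"
    and b': "\<And>t. t \<in> {0..T} \<Longrightarrow> 0 \<le> time_deriv T b t"
    using ab_Q by (auto simp: Q_class_def)
  have a_mono: "mono_on {0..T} a"
    using diff a' by (auto intro: mono_on_if_time_deriv_nonneg)
  \<comment> \<open>Growth from \<open>a 0 > 0\<close> keeps \<open>a\<close> positive, which
    justifies the cancellation of \<open>a t\<close> and the final division by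
    \<open>a T\<close>.\<close>
  have a_pos: "0 < a t" if "t \<in> {0..T}" for t
    using mono_onD[OF a_mono, of 0 t] a0 that by auto
  show E_diff: "energy a b F xs x differentiable_on {0..T}"
    using energy_has_vector_derivative[OF F_diff diff x_diff] differentiableI_vector
    unfolding differentiable_on_def by blast
  show E': "0 \<le> time_deriv T (energy a b F xs x) t"
    if "t \<in> {0..T}" "sufficient_condition T a b c d u Os x t" for t
  proof (rule time_deriv_energy_nonneg[OF T_pos that(1) F_diff F_nonneg diff x_diff _ _ that(2)])
    show "F xs \<le> bound_form F c d u x t"
      \<comment> \<open>The third conjunct of the sufficient condition is the constraint under which
        \<open>U_bound\<close> holds.\<close>
      using U_bound that by (simp add: sufficient_condition_def)
  qed (use a_pos[OF that(1)] b'[OF that(1)] in auto)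
  assume cond: "\<forall>t\<in>{0..T}. sufficient_condition T a b c d u Os x t"
  show E_mono: "mono_on {0..T} (energy a b F xs x)"
    using E_diff E' cond by (auto intro: mono_on_if_time_deriv_nonneg)
  have aT: "0 < a T"
    using a_pos T_pos by simp
  \<comment> \<open>Comparing the two ends of the trajectory and dividing by \<open>a T\<close>
    gives the guarantee for the output.\<close>
  have "energy a b F xs x 0 \<le> energy a b F xs x T"
    using mono_onD[OF E_mono, of 0 T] T_pos by simp
  then show "F (x T) \<ge> (b T - b 0) / a T * F xs + a 0 / a T * F (x 0)"
    using aT by (simp add: energy_def field_simps)
  show "(b T - b 0) / a T * F xs + a 0 / a T * F (x 0) \<ge> (b T - b 0) / a T * F xs"
    using a0 aT F_nonneg[of "x 0"] by simp
qed

end
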